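(* Let $K>0$ and let $f:[0,\infty)\to[0,\infty)$ be continuous with $f(0)=0$, $f(K)=K$ and $f(x)>x$ for all $x\in(0,K)$. Assume that for some $\bar\delta>0$ we have $f(x+a)-f(x)>a$ for all $x,a\in(0,\bar\delta)$. Let $(\gamma_n)_{n\ge1}$ be a real sequence with $\lim_{n\to\infty}\gamma_n=0$ having infinitely many negative and infinitely many positive terms, and let $(\beta_n)_{n\ge1}$ be the associated sequence of grouped perturbations defined in the context. Assume that $\lim_{n\to\infty}\beta_n=0$ and that $f(\beta_{2k})>\beta_{2k+1}$ for all sufficiently large $k\in\mathbb N$. Then no solution $(x_n)$, with $x_0>0$, of $$x_{n+1}=\max\{f(x_n)+\gamma_{n+1},0\},\quad n=0,1,\dots,$$ converges to $0$; that is, it is not the case that $\lim_{n\to\infty}x_n=0$.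
   Context: Grouping of consecutive perturbations of the same sign: define $$n_0=\inf\{i>1:\gamma_i<0\}-1,\qquad n_1=\inf\{i>n_0:\gamma_i>0\}-1,$$ and for $k=1,2,\dots$ $$n_{2k}=\inf\{i>n_{2k-1}:\gamma_i<0\}-1,\qquad n_{2k+1}=\inf\{i>n_{2k}:\gamma_i>0\}-1.$$ Then set $$\beta_{2k}=\sum_{i=n_{2k-1}+1}^{n_{2k}}\gamma_i>0\ (k\ge1),\qquad \beta_{2k+1}=-\sum_{i=n_{2k}+1}^{n_{2k+1}}\gamma_i>0\ (k\ge0).$$ *)

theory Defs
  imports Complex_Main "HOL-Library.FuncSet"
begin

text \<open>
  Perturbations are indexed from 1: \<open>\<gamma> 0\<close> plays no role.
  The infima are attained minima of sets of naturals whenever \<open>\<gamma>\<close> takes both signs infinitely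
  often; in that case every subtraction of 1 is also the true one, since all the indices
  involved exceed 1.  (Otherwise \<open>Inf {} = 0\<close> gives meaningless values.)
\<close>

fun block_end :: "(nat \<Rightarrow> real) \<Rightarrow> nat \<Rightarrow> nat" where
  "block_end \<gamma> 0 = Inf {i. i > 1 \<and> \<gamma> i < 0} - 1"
| "block_end \<gamma> (Suc j) =
     (if even j then Inf {i. i > block_end \<gamma> j \<and> \<gamma> i > 0} - 1
      else Inf {i. i > block_end \<gamma> j \<and> \<gamma> i < 0} - 1)"

text \<open>
  Only the values at \<open>j \<ge> 1\<close> are meaningful; at \<open>j = 0\<close> the sum is empty.
\<close>

definition grouped :: "(nat \<Rightarrow> real) \<Rightarrow> nat \<Rightarrow> real" where
  "grouped \<gamma> j =
     (if even j then (\<Sum>i = block_end \<gamma> (j - 1) + 1..block_end \<gamma> j. \<gamma> i)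
      else - (\<Sum>i = block_end \<gamma> (j - 1) + 1..block_end \<gamma> j. \<gamma> i))"

end

theory Submission
  imports Defs
begin

text \<open>
  Near \<open>0\<close> the hypotheses give \<open>f b - f a \<ge> b - a\<close> for \<open>0 \<le> a \<le> b\<close>; the case \<open>a = 0\<close> is
  \<open>f b \<ge> b\<close>. Let \<open>y\<close> be the value of a small solution at the end of a
  negative block. The next positive block raises it to at least \<open>y + \<beta>\<^bsub>2k\<^esub>\<close>, and the
  following negative block leaves at least
  \<open>f (y + \<beta>\<^bsub>2k\<^esub>) - \<beta>\<^bsub>2k+1\<^esub> \<ge> y + f \<beta>\<^bsub>2k\<^esub> - \<beta>\<^bsub>2k+1\<^esub> > y\<close>.
  So the solution increases strictly along the ends of the negative blocks and cannot tend
  to \<open>0\<close>.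
\<close>

text \<open>Infinitude makes the set nonempty, so its infimum is attained; exceeding
  \<open>a\<close>, it is positive and the subtraction of 1 does not truncate.\<close>

lemma Inf_greater_pred:
  fixes a :: nat
  assumes "infinite {n. P n}" and m: "m = Inf {i. i > a \<and> P i} - 1"
  shows "a \<le> m" and "P (Suc m)" and "\<And>i. a < i \<Longrightarrow> i \<le> m \<Longrightarrow> \<not> P i"
proof -
  let ?S = "{i. i > a \<and> P i}"
  have ne: "?S \<noteq> {}"
    using assms(1) by (auto simp: finite_nat_set_iff_bounded_le not_less)
  have "Inf ?S \<in> ?S"
    using ne by (rule Inf_nat_def1)
  moreover from this have "Inf ?S = Suc m"
    using m by simp
  ultimately show "a \<le> m" "P (Suc m)"
    by simp_all
  show "\<not> P i" if "a < i" "i \<le> m" for i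
    using that \<open>Inf ?S = Suc m\<close> cInf_lower[of i ?S] by fastforce
qed

context
  fixes \<gamma> :: "nat \<Rightarrow> real"
  assumes inf_neg: "infinite {n. \<gamma> n < 0}" and inf_pos: "infinite {n. \<gamma> n > 0}"
begin

lemma sign_after_block_end:
  "if even j then \<gamma> (Suc (block_end \<gamma> j)) < 0 else \<gamma> (Suc (block_end \<gamma> j)) > 0"
proof (cases j)
  case 0
  then show ?thesis
    using Inf_greater_pred(2)[OF inf_neg refl, of 1] by simp
next
  case (Suc i)
  then show ?thesis
    using Inf_greater_pred(2)[OF inf_neg refl, of "block_end \<gamma> i"]
      Inf_greater_pred(2)[OF inf_pos refl, of "block_end \<gamma> i"] by simp
qed

lemma block_end_less_Suc: "block_end \<gamma> j < block_end \<gamma> (Suc j)"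
proof -
  have "block_end \<gamma> j \<le> block_end \<gamma> (Suc j)"
    using Inf_greater_pred(1)[OF inf_neg refl, of "block_end \<gamma> j"]
      Inf_greater_pred(1)[OF inf_pos refl, of "block_end \<gamma> j"] by simp
  \<comment> \<open>The perturbations right after the two ends have opposite signs.\<close>
  moreover have "block_end \<gamma> j \<noteq> block_end \<gamma> (Suc j)"
    using sign_after_block_end[of j] sign_after_block_end[of "Suc j"]
    by (auto split: if_splits simp del: block_end.simps)
  ultimately show ?thesis
    by linarith
qed

lemma strict_mono_block_end: "strict_mono (block_end \<gamma>)"
  using block_end_less_Suc by (simp add: strict_mono_Suc_iff del: block_end.simps)

text \<open>For odd \<open>j\<close> the next block stops just before the first negative term. Zero
  terms may lie inside it, so the bound is weak.\<close>

lemma sign_in_positive_block: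
  assumes "odd j" "block_end \<gamma> j < i" "i \<le> block_end \<gamma> (Suc j)"
  shows "\<gamma> i \<ge> 0"
  using Inf_greater_pred(3)[OF inf_neg refl, of "block_end \<gamma> j" i] assms by simp

end

lemma sum_le_growth:
  fixes x \<gamma> :: "nat \<Rightarrow> real"
  assumes "a \<le> b" and "\<And>m. a \<le> m \<Longrightarrow> x m + \<gamma> (Suc m) \<le> x (Suc m)"
  shows "x a + (\<Sum>i = Suc a..b. \<gamma> i) \<le> x b"
  using assms(1)
proof (induction b rule: dec_induct)
  case base
  then show ?case by simp
next
  case (step b)
  then show ?case
    using assms(2)[of b] by simp
qed

theorem proposition3p8:
  fixes K :: real and f :: "real \<Rightarrow> real" and \<gamma> :: "nat \<Rightarrow> real"
  assumes "K > 0"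
    and "f \<in> {0..} \<rightarrow> {0..}"
    and "continuous_on {0..} f"
    and "f 0 = 0"
    and "f K = K"
    and "\<forall>x\<in>{0<..<K}. f x > x"
    and "\<exists>\<delta>>0. \<forall>x\<in>{0<..<\<delta>}. \<forall>a\<in>{0<..<\<delta>}. f (x + a) - f x > a"
    and "\<gamma> \<longlonglongrightarrow> 0"
    and "infinite {n. n \<ge> 1 \<and> \<gamma> n < 0}"
    and "infinite {n. n \<ge> 1 \<and> \<gamma> n > 0}"
    and "grouped \<gamma> \<longlonglongrightarrow> 0"
    and "\<forall>\<^sub>F k in sequentially. f (grouped \<gamma> (2 * k)) > grouped \<gamma> (2 * k + 1)"
  shows "\<not> (\<exists>x :: nat \<Rightarrow> real. x 0 > 0
           \<and> (\<forall>n. x (n + 1) = max (f (x n) + \<gamma> (n + 1)) 0)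
           \<and> x \<longlonglongrightarrow> 0)"
proof
  assume "\<exists>x :: nat \<Rightarrow> real. x 0 > 0
           \<and> (\<forall>n. x (n + 1) = max (f (x n) + \<gamma> (n + 1)) 0)
           \<and> x \<longlonglongrightarrow> 0"
  then obtain x :: "nat \<Rightarrow> real" where x0: "x 0 > 0"
    and rec: "\<And>n. x (Suc n) = max (f (x n) + \<gamma> (Suc n)) 0" and lim: "x \<longlonglongrightarrow> 0"
    by auto
  obtain \<delta> where "\<delta> > 0"
    and \<delta>: "\<And>x a. 0 < x \<Longrightarrow> x < \<delta> \<Longrightarrow> 0 < a \<Longrightarrow> a < \<delta> \<Longrightarrow> f (x + a) - f x > a"
    using assms(7) by (metis greaterThanLessThan_iff)
  \<comment> \<open>Below \<open>d\<close> both \<open>f z > z\<close> for positive \<open>z\<close>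
    and the expansion hypothesis are available.\<close>
  define d where "d = min \<delta> K"
  have "d > 0"
    using \<open>\<delta> > 0\<close> assms(1) by (simp add: d_def)
  have f_ge: "z \<le> f z" if "0 \<le> z" "z < d" for z
  proof (cases "z = 0")
    case False
    then have "z \<in> {0<..<K}"
      using that by (simp add: d_def)
    then show ?thesis
      using assms(6) by fastforce
  qed (simp add: assms(4))
  have f_expand: "b - a \<le> f b - f a" if "0 \<le> a" "a \<le> b" "b < d" for a b
  proof (cases "a = 0 \<or> a = b")
    case True
    then show ?thesis
      using f_ge[of b] that assms(4) by auto
  next
    case False
    then show ?thesis
      using \<delta>[of a "b - a"] that by (simp add: d_def)
  qed
  have inf: "infinite {n. \<gamma> n < 0}" "infinite {n. \<gamma> n > 0}"
    using assms(9,10) by (auto elim!: contrapos_nn elim: rev_finite_subset)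
  note mono = strict_mono_block_end[OF inf]
  have nonneg: "0 \<le> x n" for n
    using x0 rec by (cases n) auto
  obtain N where N: "\<And>n. n \<ge> N \<Longrightarrow> x n < d"
    using order_tendstoD(2)[OF lim \<open>d > 0\<close>] unfolding eventually_sequentially by blast
  \<comment> \<open>Truncation at 0 can only raise the value, so the lower bound survives the
    \<open>max\<close>.\<close>
  have grow: "x m + \<gamma> (Suc m) \<le> x (Suc m)" if "m \<ge> N" for m
    using f_ge[OF nonneg N[OF that]] rec[of m] by linarith
  obtain M where M: "\<And>k. k \<ge> M \<Longrightarrow> f (grouped \<gamma> (2 * k)) > grouped \<gamma> (2 * k + 1)"
    using assms(12) unfolding eventually_sequentially by blast
  \<comment> \<open>Odd indices of \<open>block_end\<close> are the ends of negative blocks.\<close>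
  define y where "y k = x (block_end \<gamma> (Suc (2 * k)))" for k
  have y_less: "y k < y (Suc k)" if k: "k \<ge> max M N" for k
  proof -
    define n p q where npq: "n = block_end \<gamma> (Suc (2 * k))"
      "p = block_end \<gamma> (2 * Suc k)" "q = block_end \<gamma> (Suc (2 * Suc k))"
    define b where "b = grouped \<gamma> (2 * Suc k)"
    define c where "c = grouped \<gamma> (Suc (2 * Suc k))"
    have "n \<ge> Suc (2 * k)"
      unfolding npq by (rule strict_mono_imp_increasing[OF mono])
    then have "n \<ge> N"
      using k by linarith
    have "n < p" "p < q"
      unfolding npq using mono by (simp_all add: strict_mono_less del: block_end.simps)
    have b: "b = (\<Sum>i = Suc n..p. \<gamma> i)"
      by (simp add: b_def npq grouped_def del: block_end.simps)
    have c: "c = - (\<Sum>i = Suc p..q. \<gamma> i)"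
      by (simp add: c_def npq grouped_def del: block_end.simps)
    have "0 \<le> b"
      unfolding b
      by (rule sum_nonneg)
        (use sign_in_positive_block[OF inf, of "Suc (2 * k)"] in
          \<open>simp add: npq del: block_end.simps\<close>)
    have xp: "x n + b \<le> x p"
      unfolding b using \<open>n < p\<close> \<open>n \<ge> N\<close> by (intro sum_le_growth grow) auto
    have "x p < d"
      using N \<open>n \<ge> N\<close> \<open>n < p\<close> by simp
    \<comment> \<open>Expansion from \<open>b\<close> to \<open>x p\<close> gives
      \<open>f (x p) - f b \<ge> x p - b\<close>, and \<open>x p - b \<ge> x n\<close>.\<close>
    then have "x n + f b \<le> f (x p)"
      using f_expand[of b "x p"] xp \<open>0 \<le> b\<close> nonneg[of n] by linarith
    moreover have "f (x p) + \<gamma> (Suc p) \<le> x (Suc p)"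
      using rec[of p] by simp
    \<comment> \<open>The first step of the negative block is kept apart: it alone retains
      \<open>f (x p)\<close>, while the later steps need only \<open>grow\<close>.\<close>
    moreover have "x (Suc p) + (\<Sum>i = Suc (Suc p)..q. \<gamma> i) \<le> x q"
      using \<open>n < p\<close> \<open>p < q\<close> \<open>n \<ge> N\<close> by (intro sum_le_growth grow) auto
    moreover have "c = - \<gamma> (Suc p) - (\<Sum>i = Suc (Suc p)..q. \<gamma> i)"
      unfolding c using \<open>p < q\<close> by (simp add: sum.atLeast_Suc_atMost)
    moreover have "c < f b"
      using M[of "Suc k"] k by (simp add: b_def c_def)
    ultimately have "x n < x q"
      by linarith
    then show ?thesis
      by (simp add: y_def npq del: block_end.simps)
  qed
  \<comment> \<open>At \<open>max M N\<close> only \<open>y \<ge> 0\<close> is known, since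
    truncation may give 0; one strict increase makes \<open>y L\<close> positive.\<close>
  define L where "L = Suc (max M N)"
  have "0 < y L"
    using y_less[of "max M N"] nonneg[of "block_end \<gamma> (Suc (2 * max M N))"]
    unfolding L_def y_def by linarith
  have "y L \<le> y k" if "k \<ge> L" for k
    using that
  proof (induction k rule: dec_induct)
    case (step k)
    then show ?case
      using y_less[of k] unfolding L_def by force
  qed simp
  moreover have "y \<longlonglongrightarrow> 0"
  proof -
    have "strict_mono (\<lambda>k. block_end \<gamma> (Suc (2 * k)))"
      using mono by (simp add: strict_mono_def del: block_end.simps)
    from LIMSEQ_subseq_LIMSEQ[OF lim this] show ?thesis
      by (simp add: y_def[abs_def] comp_def del: block_end.simps)
  qed
  ultimately have "y L \<le> 0"
    by (intro LIMSEQ_le_const) auto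
  with \<open>0 < y L\<close> show False
    by simp
qed

end
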